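(* Let $p,q$ be coprime positive integers. For $|z|<1$, the generating function $G_{p,q}(z)=\sum_{m\ge0}S_m(p,q)\,z^m$ admits the closed form $$G_{p,q}(z)=\frac{pq}{1-z^{pq}}-\frac{p}{1-z^p}-\frac{q}{1-z^q}+\frac{1}{1-z},$$ and it extends meromorphically to $\mathbb{C}$, its singularities being simple poles located at roots of unity $\xi$ with $\xi^r=1$ for some $r\in\{1,p,q,pq\}$. For a root of unity $\xi$ with $\xi^r=1$ for some $r\in\{1,p,q,pq\}$, $$\operatorname{Res}_{z=\xi}G_{p,q}(z)=-\mathbf{1}_{\xi^{pq}=1}\,\xi^{-(pq-1)}+\mathbf{1}_{\xi^{p}=1}\,\xi^{-(p-1)}+\mathbf{1}_{\xi^{q}=1}\,\xi^{-(q-1)}-\mathbf{1}_{\xi=1}.$$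
   Context: For coprime positive integers $p,q$, $\Delta_{p,q}(t)=\frac{(t^{pq}-1)(t-1)}{(t^p-1)(t^q-1)}$ is the Alexander polynomial of the torus knot $T_{p,q}$; its zero set is $\mathcal{Z}_{p,q}=\{\zeta\in\mathbb{C}:\zeta^{pq}=1,\ \zeta^p\ne1,\ \zeta^q\neq1\}$ (all zeros simple). For $m\ge0$ the $m$-th moment is $S_m(p,q)=\sum_{\alpha}\alpha^m$, the sum over all zeros $\alpha$ of $\Delta_{p,q}$ counted with multiplicity. $\mathbf{1}_P$ denotes $1$ if $P$ holds and $0$ otherwise. *)

theory Defs
  imports
    "HOL-Complex_Analysis.Complex_Analysis"
    "HOL-Computational_Algebra.Fundamental_Theorem_Algebra"
    "HOL-Computational_Algebra.Polynomial_Factorial"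
    "HOL-Computational_Algebra.Field_as_Ring"
begin

text \<open>The division is that of polynomials over a field; for positive coprime \<open>p\<close> and \<open>q\<close>
  it is exact, see \<open>torus_alexander_exact\<close> below.\<close>

definition torus_alexander :: "nat \<Rightarrow> nat \<Rightarrow> complex poly" where
  "torus_alexander p q =
     ((monom 1 (p * q) - 1) * (monom 1 1 - 1)) div ((monom 1 p - 1) * (monom 1 q - 1))"

definition moment :: "nat \<Rightarrow> nat \<Rightarrow> nat \<Rightarrow> complex" where
  "moment p q m = (\<Sum>\<alpha>\<in>#proots (torus_alexander p q). \<alpha> ^ m)"

definition moment_gf :: "nat \<Rightarrow> nat \<Rightarrow> complex \<Rightarrow> complex" where
  "moment_gf p q z = (\<Sum>m. moment p q m * z ^ m)"

lemma monom_minus_one_factor: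
  "monom 1 n - 1 = (monom 1 1 - 1) * (\<Sum>i<n. monom (1 :: complex) i)"
proof -
  have "monom (1 :: complex) 1 ^ i = monom 1 i" for i
    by (simp only: monom_power power_one mult_1)
  then show ?thesis
    using power_diff_1_eq[of "monom (1 :: complex) 1" n] by simp
qed

lemma monom_minus_one_nonzero:
  assumes "n > 0"
  shows "monom 1 n - 1 \<noteq> (0 :: complex poly)"
proof
  assume "monom 1 n - 1 = (0 :: complex poly)"
  then have "poly (monom 1 n - 1) 0 = (0 :: complex)"
    by simp
  with assms show False
    by (simp add: poly_monom zero_power)
qed

lemma coprime_geometric_sums:
  assumes "p > 0" "coprime p q"
  shows "coprime (\<Sum>i<p. monom (1 :: complex) i) (\<Sum>i<q. monom 1 i)"
proof (rule coprimeI)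
  fix d :: "complex poly"
  assume dvd: "d dvd (\<Sum>i<p. monom 1 i)" "d dvd (\<Sum>i<q. monom 1 i)"
  have no_root: "poly d x \<noteq> 0" for x
  proof
    assume "poly d x = 0"
    with dvd have x: "poly (\<Sum>i<p. monom 1 i) x = 0" "poly (\<Sum>i<q. monom 1 i) x = 0"
      by (auto elim!: dvdE)
    have "poly (monom 1 n - 1) x = 0" if "poly (\<Sum>i<n. monom 1 i) x = 0" for n
      by (subst monom_minus_one_factor) (simp add: that)
    with x have pow: "x ^ p = 1" "x ^ q = 1"
      by (auto simp: poly_monom)
    from assms obtain a b where "p * a = q * b + 1"
      using bezout_nat[of p q] by auto
    then have "x ^ (p * a) = x ^ (q * b) * x"
      by simp
    with pow have "x = 1"
      by (simp add: power_mult)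
    with x(1) assms(1) show False
      by (simp add: poly_sum poly_monom)
  qed
  have "degree d = 0"
    using no_root alg_closed_imp_poly_has_root[of d] by auto
  moreover have "d \<noteq> 0"
    using no_root[of 0] by auto
  ultimately show "is_unit d"
    by (simp add: is_unit_iff_degree)
qed

lemma torus_alexander_exact:
  assumes "p > 0" "q > 0" "coprime p q"
  shows "torus_alexander p q * ((monom 1 p - 1) * (monom 1 q - 1)) =
           (monom 1 (p * q) - 1) * (monom 1 1 - 1)"
proof -
  define g :: "nat \<Rightarrow> complex poly" where "g n = (\<Sum>i<n. monom 1 i)" for n
  define u :: "complex poly" where "u = monom 1 1 - 1"
  have fac: "monom 1 n - 1 = u * g n" for n
    unfolding g_def u_def by (rule monom_minus_one_factor)
  have "u \<noteq> 0"
    unfolding u_def by (rule monom_minus_one_nonzero) simp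
  have g_dvd: "g m dvd g (m * k)" for m k
  proof -
    have "monom (1 :: complex) m - 1 dvd monom 1 m ^ k - 1"
      by (simp add: power_diff_1_eq)
    then have "u * g m dvd u * g (m * k)"
      using fac[of "m * k"] by (simp add: fac monom_power mult.commute)
    with \<open>u \<noteq> 0\<close> show ?thesis
      by simp
  qed
  have "g p * g q dvd g (p * q)"
  proof (rule divides_mult)
    show "g p dvd g (p * q)"
      by (rule g_dvd)
    show "g q dvd g (p * q)"
      using g_dvd[of q p] by (simp add: mult.commute)
    show "coprime (g p) (g q)"
      unfolding g_def using assms by (intro coprime_geometric_sums)
  qed
  then have "(u * u) * (g p * g q) dvd (u * u) * g (p * q)"
    by (rule mult_dvd_mono[OF dvd_refl])
  then have "(monom 1 p - 1) * (monom 1 q - 1) dvd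
               (monom 1 (p * q) - 1) * (monom (1 :: complex) 1 - 1)"
    unfolding fac[of p] fac[of q] fac[of "p * q"] u_def[symmetric] by (simp only: mult_ac)
  then show ?thesis
    unfolding torus_alexander_def by (rule dvd_div_mult_self)
qed

end

theory Submission
  imports Defs
begin

text \<open>Comparing root multisets in the exact factorization expresses each moment through the power
  sums of the \<open>n\<close>-th roots of unity, which are \<open>n\<close> or \<open>0\<close> according to whether \<open>n\<close> divides the
  exponent; geometric series then give the closed form. All singularities are at most simple,
  since \<open>n (z - \<xi>) / (1 - z\<^sup>n)\<close> has a limit at every \<open>\<xi>\<close>, and the limits
  add up to the residue. Where they cancel, the singularity is removable; hence the extension is
  the closed form with its removable singularities filled in.\<close>

section \<open>Roots of unity and the moments\<close>

lemma proots_monom_minus_one: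
  assumes "n > 0"
  shows "proots (monom 1 n - 1) = mset_set {z :: complex. z ^ n = 1}"
proof (rule multiset_eqI)
  fix x :: complex
  let ?P = "monom 1 n - 1 :: complex poly"
  have nz: "?P \<noteq> 0"
    using assms by (rule monom_minus_one_nonzero)
  have root: "poly ?P z = 0 \<longleftrightarrow> z ^ n = 1" for z
    by (simp add: poly_monom)
  \<comment> \<open>The derivative \<open>n * z ^ (n - 1)\<close> vanishes at most at 0, which is no
    root since \<open>n > 0\<close>; hence every root is simple.\<close>
  have "poly (pderiv ?P) z \<noteq> 0" if "z ^ n = 1" for z
    using that assms by (auto simp: pderiv_diff pderiv_monom poly_monom power_0_left)
  then have "rsquarefree ?P"
    using root by (auto simp: rsquarefree_roots)
  then have "order x ?P = 0 \<or> order x ?P = 1"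
    by (auto simp: rsquarefree_def)
  then have "order x ?P = of_bool (x ^ n = 1)"
    using root[of x] nz order_root[of ?P x] by (cases "x ^ n = 1") auto
  then show "count (proots ?P) x = count (mset_set {z. z ^ n = 1}) x"
    using finite_roots_unity[of n, where 'a = complex] assms nz
    by (simp add: count_mset_set')
qed

lemma sum_power_roots_unity:
  assumes "n > 0"
  shows "(\<Sum>z | z ^ n = (1 :: complex). z ^ m) = of_nat n * of_bool (n dvd m)"
proof (cases "n dvd m")
  case True
  then obtain k where "m = n * k" ..
  then have "(\<Sum>z | z ^ n = (1 :: complex). z ^ m) = (\<Sum>z | z ^ n = (1 :: complex). 1)"
    by (intro sum.cong) (auto simp: power_mult)
  with True assms show ?thesis
    by (simp add: card_roots_unity_eq)
next
  case False
  \<comment> \<open>A primitive \<open>n\<close>-th root of unity: \<open>w ^ m = 1\<close> would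
    force \<open>n dvd m\<close>.\<close>
  define w where "w = cis (2 * pi / real n)"
  have "w ^ n = cis (real n * (2 * pi / real n))"
    unfolding w_def by (rule Complex.DeMoivre)
  then have w: "w ^ n = 1" "w \<noteq> 0"
    using assms by (simp_all add: w_def)
  have "w ^ m \<noteq> 1"
  proof
    assume "w ^ m = 1"
    moreover have "w ^ m = cis (real m * (2 * pi / real n))"
      unfolding w_def by (rule Complex.DeMoivre)
    ultimately have "exp (2 * of_real pi * \<i> * of_nat m / of_nat n) = 1"
      by (simp add: cis_conv_exp mult_ac)
    with False assms show False
      by (simp add: complex_root_unity_eq_1)
  qed
  \<comment> \<open>Rotation by \<open>w\<close> permutes the roots of unity and scales the sum by \<open>w ^ m \<noteq> 1\<close>.\<close>
  let ?S = "\<Sum>z | z ^ n = (1 :: complex). z ^ m"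
  have "?S = (\<Sum>z | z ^ n = (1 :: complex). (w * z) ^ m)"
    by (rule sum.reindex_bij_witness[where i = "\<lambda>z. w * z" and j = "\<lambda>z. z / w"])
       (use w in \<open>auto simp: power_mult_distrib power_divide\<close>)
  also have "\<dots> = w ^ m * ?S"
    by (simp only: power_mult_distrib sum_distrib_left)
  finally show ?thesis
    using \<open>w ^ m \<noteq> 1\<close> False by simp
qed

lemma moment_eq:
  assumes "p > 0" "q > 0" "coprime p q"
  shows "moment p q m =
    of_nat (p * q) * of_bool (p * q dvd m) - of_nat p * of_bool (p dvd m)
      - of_nat q * of_bool (q dvd m) + 1"
proof -
  have nz: "monom 1 n - 1 \<noteq> (0 :: complex poly)" if "n > 0" for n
    using that by (rule monom_minus_one_nonzero)
  have ps: "(\<Sum>\<alpha>\<in>#proots (monom 1 n - 1). \<alpha> ^ m) = (of_nat n * of_bool (n dvd m) :: complex)"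
    if "n > 0" for n
    using that by (simp add: proots_monom_minus_one sum_power_roots_unity sum_unfold_sum_mset[symmetric])
  have prod: "torus_alexander p q * ((monom 1 p - 1) * (monom 1 q - 1)) =
           (monom 1 (p * q) - 1) * (monom 1 1 - 1)"
    using assms by (rule torus_alexander_exact)
  \<comment> \<open>Root multisets add under multiplication only for nonzero factors; a zero factor
    here would annihilate the nonzero right-hand side.\<close>
  then have "torus_alexander p q \<noteq> 0"
    using assms nz by (metis mult_eq_0_iff nat_0_less_mult_iff zero_less_one)
  then have "proots (torus_alexander p q) + (proots (monom 1 p - 1) + proots (monom 1 q - 1)) =
      proots (monom 1 (p * q) - 1) + proots (monom 1 1 - 1)"
    using arg_cong[OF prod, of proots] assms nz
    by (simp add: proots_mult)
  \<comment> \<open>The summand 1 is the power sum for \<open>n = 1\<close>, coming from the factor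
    \<open>monom 1 1 - 1\<close>.\<close>
  from arg_cong[OF this, of "\<lambda>A. \<Sum>\<alpha>\<in>#A. \<alpha> ^ m"] assms
  have "moment p q m + (of_nat p * of_bool (p dvd m) + of_nat q * of_bool (q dvd m)) =
      of_nat (p * q) * of_bool (p * q dvd m) + 1"
    unfolding image_mset_union sum_mset.union moment_def by (subst (asm) (1 2 3 4) ps) auto
  then show ?thesis
    by (simp add: algebra_simps)
qed

section \<open>The closed form on the unit disc\<close>

lemma sums_of_bool_dvd_power:
  fixes z :: complex
  assumes "n > 0" "norm z < 1"
  shows "(\<lambda>m. of_bool (n dvd m) * z ^ m) sums (1 / (1 - z ^ n))"
proof -
  have "norm (z ^ n) < 1"
    using assms by (simp add: norm_power power_less_one_iff)
  then have "(\<lambda>k. (z ^ n) ^ k) sums (1 / (1 - z ^ n))"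
    by (rule geometric_sums)
  then have "(\<lambda>k. of_bool (n dvd n * k) * z ^ (n * k)) sums (1 / (1 - z ^ n))"
    by (simp add: power_mult)
  \<comment> \<open>The terms vanish off the multiples of \<open>n\<close>, which are the range of
    the strictly increasing map from \<open>k\<close> to \<open>n * k\<close>.\<close>
  then show ?thesis
    by (rule sums_mono_reindex[THEN iffD1, rotated 2]) (use assms in \<open>auto simp: strict_mono_def\<close>)
qed

text \<open>Since division by zero yields 0, the values at the roots of unity that annul a
  denominator carry no meaning; \<open>remove_sings\<close> corrects them later.\<close>

definition torus_gf :: "nat \<Rightarrow> nat \<Rightarrow> complex \<Rightarrow> complex" where
  "torus_gf p q z =
     of_nat (p * q) / (1 - z ^ (p * q)) - of_nat p / (1 - z ^ p)
       - of_nat q / (1 - z ^ q) + 1 / (1 - z)"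

lemma moment_sums:
  assumes "p > 0" "q > 0" "coprime p q" "norm z < 1"
  shows "(\<lambda>m. moment p q m * z ^ m) sums torus_gf p q z"
proof -
  have s: "(\<lambda>m. of_nat n * (of_bool (n dvd m) * z ^ m)) sums (of_nat n * (1 / (1 - z ^ n)))"
    if "n > 0" for n
    using that assms by (intro sums_mult sums_of_bool_dvd_power) auto
  have "(\<lambda>m. of_nat (p * q) * (of_bool (p * q dvd m) * z ^ m) - of_nat p * (of_bool (p dvd m) * z ^ m)
      - of_nat q * (of_bool (q dvd m) * z ^ m) + of_nat 1 * (of_bool (1 dvd m) * z ^ m)) sums
     (of_nat (p * q) * (1 / (1 - z ^ (p * q))) - of_nat p * (1 / (1 - z ^ p))
       - of_nat q * (1 / (1 - z ^ q)) + of_nat 1 * (1 / (1 - z ^ 1)))"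
    using assms by (intro sums_add sums_diff s) auto
  also have "(\<lambda>m. of_nat (p * q) * (of_bool (p * q dvd m) * z ^ m) - of_nat p * (of_bool (p dvd m) * z ^ m)
      - of_nat q * (of_bool (q dvd m) * z ^ m) + of_nat 1 * (of_bool (1 dvd m) * z ^ m)) =
      (\<lambda>m. moment p q m * z ^ m)"
    using assms by (simp add: moment_eq algebra_simps fun_eq_iff)
  finally show ?thesis
    by (simp add: torus_gf_def)
qed

section \<open>Poles and residues of the closed form\<close>

lemma torus_gf_meromorphic: "torus_gf p q meromorphic_on A"
  unfolding torus_gf_def by (intro meromorphic_intros)

lemma torus_gf_analytic_at:
  assumes "\<And>r. r \<in> {1, p, q, p * q} \<Longrightarrow> z ^ r \<noteq> 1"
  shows "torus_gf p q analytic_on {z}"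
  unfolding torus_gf_def using assms[of 1] assms[of p] assms[of q] assms[of "p * q"]
  by (intro analytic_intros) auto

text \<open>At an \<open>n\<close>-th root of unity the difference quotient of \<open>w ^ n\<close>
  tends to the nonzero derivative \<open>n * \<xi> ^ (n - 1)\<close>, and its reciprocal gives the
  limit. Elsewhere the quotient is continuous and the factor \<open>w - \<xi>\<close> tends to
  0.\<close>

lemma tendsto_residue_one_minus_power:
  fixes \<xi> :: complex
  assumes "n > 0"
  shows "((\<lambda>w. of_nat n / (1 - w ^ n) * (w - \<xi>)) \<longlongrightarrow>
           - of_bool (\<xi> ^ n = 1) * \<xi> powi (- (int n - 1))) (at \<xi>)"
proof (cases "\<xi> ^ n = 1")
  case True
  then have "\<xi> \<noteq> 0"
    using assms by (auto simp: power_0_left)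
  have "((\<lambda>w. w ^ n) has_field_derivative of_nat n * \<xi> ^ (n - 1)) (at \<xi>)"
    by (auto intro!: derivative_eq_intros)
  then have "((\<lambda>w. (w ^ n - 1) / (w - \<xi>)) \<longlongrightarrow> of_nat n * \<xi> ^ (n - 1)) (at \<xi>)"
    using True by (simp add: has_field_derivative_iff)
  then have "((\<lambda>w. - of_nat n / ((w ^ n - 1) / (w - \<xi>))) \<longlongrightarrow> - of_nat n / (of_nat n * \<xi> ^ (n - 1))) (at \<xi>)"
    using \<open>\<xi> \<noteq> 0\<close> assms by (intro tendsto_intros) auto
  \<comment> \<open>The functions agree everywhere: where \<open>w = \<xi>\<close> or
    \<open>w ^ n = 1\<close>, both sides are 0 because division by zero is 0.\<close>
  also have "(\<lambda>w. - of_nat n / ((w ^ n - 1) / (w - \<xi>))) = (\<lambda>w. of_nat n / (1 - w ^ n) * (w - \<xi>))"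
    by (auto simp: fun_eq_iff divide_simps) (simp_all add: algebra_simps)
  also have "- of_nat n / (of_nat n * \<xi> ^ (n - 1)) = - of_bool (\<xi> ^ n = 1) * \<xi> powi (- (int n - 1))"
  proof -
    have "int n - 1 = int (n - 1)"
      using assms by simp
    then show ?thesis
      using True assms by (simp only: power_int_minus power_int_of_nat) (simp add: field_simps)
  qed
  finally show ?thesis .
next
  case False
  then have "((\<lambda>w. of_nat n / (1 - w ^ n) * (w - \<xi>)) \<longlongrightarrow> of_nat n / (1 - \<xi> ^ n) * (\<xi> - \<xi>)) (at \<xi>)"
    by (intro tendsto_intros) auto
  with False show ?thesis
    by simp
qed

lemma torus_gf_tendsto_residue:
  assumes "p > 0" "q > 0"
  shows "((\<lambda>w. torus_gf p q w * (w - \<xi>)) \<longlongrightarrow>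
    - of_bool (\<xi> ^ (p * q) = 1) * \<xi> powi (- (int (p * q) - 1))
    + of_bool (\<xi> ^ p = 1) * \<xi> powi (- (int p - 1))
    + of_bool (\<xi> ^ q = 1) * \<xi> powi (- (int q - 1))
    - of_bool (\<xi> = 1)) (at \<xi>)"
proof -
  let ?t = "\<lambda>n w. of_nat n / (1 - w ^ n) * (w - \<xi>)"
  let ?r = "\<lambda>n. - of_bool (\<xi> ^ n = 1) * \<xi> powi (- (int n - 1))"
  have "((\<lambda>w. ?t (p * q) w - ?t p w - ?t q w + ?t 1 w) \<longlongrightarrow> ?r (p * q) - ?r p - ?r q + ?r 1) (at \<xi>)"
    using assms by (intro tendsto_add tendsto_diff tendsto_residue_one_minus_power) auto
  then show ?thesis
    by (simp add: torus_gf_def algebra_simps)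
qed

text \<open>The product \<open>f w * (w - z)\<close> extends to an analytic \<open>g\<close>. Since
  \<open>f\<close> has a pole, \<open>g z\<close> cannot be 0, so \<open>f\<close> is
  \<open>g\<close> divided by \<open>w - z\<close> with \<open>g z \<noteq> 0\<close>.\<close>

lemma zorder_simple_pole_limit:
  assumes "isolated_singularity_at f z" "is_pole f z"
      and lim: "((\<lambda>w. f w * (w - z)) \<longlongrightarrow> c) (at z)"
  shows "zorder f z = -1"
proof -
  let ?h = "\<lambda>w. f w * (w - z)"
  define g where "g = remove_sings ?h"
  have iso: "isolated_singularity_at ?h z"
    using assms(1) by (intro singularity_intros) (auto intro!: analytic_intros simp: isolated_singularity_at_analytic)
  have g: "g analytic_on {z}" "g z = c"
    unfolding g_def using iso lim by (auto intro: remove_sings_analytic_at)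
  have ev: "\<forall>\<^sub>F w in at z. g w = f w * (w - z)"
    unfolding g_def by (rule eventually_remove_sings_eq_at) fact
  \<comment> \<open>If \<open>g z = 0\<close>, then \<open>f\<close> would agree near
    \<open>z\<close> with the difference quotient of \<open>g\<close> and converge to
    \<open>deriv g z\<close>.\<close>
  have "c \<noteq> 0"
  proof
    assume "c = 0"
    have "(g has_field_derivative deriv g z) (at z)"
      using g(1) analytic_derivI by blast
    then have "((\<lambda>w. g w / (w - z)) \<longlongrightarrow> deriv g z) (at z)"
      using g \<open>c = 0\<close> by (simp add: has_field_derivative_iff)
    moreover have "\<forall>\<^sub>F w in at z. g w / (w - z) = f w"
      using ev eventually_neq_at_within[of z z UNIV] by eventually_elim auto
    ultimately have "(f \<longlongrightarrow> deriv g z) (at z)"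
      using tendsto_cong by force
    with assms(2) show False
      unfolding is_pole_def by (meson at_neq_bot not_tendsto_and_filterlim_at_infinity)
  qed
  obtain A where A: "open A" "z \<in> A" "g holomorphic_on A"
    using g(1) by (auto simp: analytic_at)
  obtain B where B: "open B" "z \<in> B" "\<And>w. w \<in> B \<Longrightarrow> w \<noteq> z \<Longrightarrow> g w = f w * (w - z)"
    using ev by (auto simp: eventually_at_topological)
  show ?thesis
  proof (rule zorder_eqI)
    show "open (A \<inter> B)" "z \<in> A \<inter> B" "g z \<noteq> 0"
      using A B g \<open>c \<noteq> 0\<close> by auto
    show "g holomorphic_on A \<inter> B"
      using A by (auto intro: holomorphic_on_subset)
  qed (use B(3) in \<open>auto simp: power_int_minus field_simps\<close>)
qed

theorem theorem5:
  fixes p q :: nat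
  assumes "p > 0" and "q > 0" and "coprime p q"
  shows
    "(\<forall>z :: complex. norm z < 1 \<longrightarrow>
        summable (\<lambda>m. moment p q m * z ^ m) \<and>
        moment_gf p q z =
          of_nat (p * q) / (1 - z ^ (p * q)) - of_nat p / (1 - z ^ p)
            - of_nat q / (1 - z ^ q) + 1 / (1 - z)) \<and>
     (\<exists>F. F nicely_meromorphic_on UNIV \<and>
        (\<forall>z. norm z < 1 \<longrightarrow> F z = moment_gf p q z) \<and>
        (\<forall>z. \<not> F analytic_on {z} \<longrightarrow>
           is_pole F z \<and> zorder F z = -1 \<and> (\<exists>r\<in>{1, p, q, p * q}. z ^ r = 1)) \<and>
        (\<forall>\<xi>. (\<exists>r\<in>{1, p, q, p * q}. \<xi> ^ r = 1) \<longrightarrow>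
           residue F \<xi> =
             - of_bool (\<xi> ^ (p * q) = 1) * \<xi> powi (- (int (p * q) - 1))
             + of_bool (\<xi> ^ p = 1) * \<xi> powi (- (int p - 1))
             + of_bool (\<xi> ^ q = 1) * \<xi> powi (- (int q - 1))
             - of_bool (\<xi> = 1)))"
proof -
  let ?G = "torus_gf p q"
  \<comment> \<open>At \<open>\<xi> = 1\<close>, for instance, the four contributions -1, 1, 1, -1
    cancel, and \<open>F\<close> takes the limit as its value.\<close>
  define F where "F = remove_sings ?G"
  have sums: "(\<lambda>m. moment p q m * z ^ m) sums ?G z" if "norm z < 1" for z
    using assms that by (rule moment_sums)
  have gf: "moment_gf p q z = ?G z" if "norm z < 1" for z
    using sums[OF that] by (simp add: moment_gf_def sums_iff)
  have iso: "isolated_singularity_at ?G z" for z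
    using torus_gf_meromorphic[of p q "{z}"] by (simp add: meromorphic_at_iff)
  have nice: "F nicely_meromorphic_on UNIV"
    unfolding F_def by (intro remove_sings_nicely_meromorphic torus_gf_meromorphic)
  \<comment> \<open>Where \<open>?G\<close> is analytic, \<open>remove_sings\<close> leaves its
    value unchanged, so \<open>F\<close> agrees with \<open>?G\<close> on the disc.\<close>
  have ana: "?G analytic_on {z}" if "norm z < 1" for z
  proof (rule torus_gf_analytic_at)
    fix r assume "r \<in> {1, p, q, p * q}"
    then have "norm (z ^ r) < 1"
      using assms that by (auto simp: norm_power power_less_one_iff)
    then show "z ^ r \<noteq> 1"
      by auto
  qed
  have sing: "is_pole F z \<and> zorder F z = -1 \<and> (\<exists>r\<in>{1, p, q, p * q}. z ^ r = 1)"
    if "\<not> F analytic_on {z}" for z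
  proof (intro conjI)
    show "is_pole F z"
      using nicely_meromorphic_on_imp_analytic_at[OF nice] that by blast
    \<comment> \<open>Filling in removable singularities changes neither poles nor their orders, so
      the order can be computed for \<open>?G\<close>.\<close>
    then have pole: "is_pole ?G z"
      by (simp add: F_def iso)
    have "zorder ?G z = -1"
      using iso pole torus_gf_tendsto_residue[OF assms(1,2)] by (rule zorder_simple_pole_limit)
    then show "zorder F z = -1"
      by (simp add: F_def iso)
    show "\<exists>r\<in>{1, p, q, p * q}. z ^ r = 1"
      using that torus_gf_analytic_at[of p q z] remove_sings_analytic_on[of ?G "{z}"]
      unfolding F_def by blast
  qed
  have res: "residue F \<xi> =
             - of_bool (\<xi> ^ (p * q) = 1) * \<xi> powi (- (int (p * q) - 1))
             + of_bool (\<xi> ^ p = 1) * \<xi> powi (- (int p - 1))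
             + of_bool (\<xi> ^ q = 1) * \<xi> powi (- (int q - 1))
             - of_bool (\<xi> = 1)" for \<xi>
  proof -
    obtain A where "open A" "\<xi> \<in> A" "?G holomorphic_on A - {\<xi>}"
      using iso[of \<xi>] analytic_imp_holomorphic isolated_singularity_at_iff_analytic_nhd by auto
    \<comment> \<open>The limit is the residue also when it is 0, so removable singularities are
      covered as well.\<close>
    from residue_simple'[OF this torus_gf_tendsto_residue[OF assms(1,2)]] show ?thesis
      by (simp add: F_def iso)
  qed
  have "\<forall>z. norm z < 1 \<longrightarrow> F z = moment_gf p q z"
    using ana gf by (simp add: F_def)
  with nice sing res have "\<exists>F. F nicely_meromorphic_on UNIV \<and>
        (\<forall>z. norm z < 1 \<longrightarrow> F z = moment_gf p q z) \<and>
        (\<forall>z. \<not> F analytic_on {z} \<longrightarrow>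
           is_pole F z \<and> zorder F z = -1 \<and> (\<exists>r\<in>{1, p, q, p * q}. z ^ r = 1)) \<and>
        (\<forall>\<xi>. (\<exists>r\<in>{1, p, q, p * q}. \<xi> ^ r = 1) \<longrightarrow>
           residue F \<xi> =
             - of_bool (\<xi> ^ (p * q) = 1) * \<xi> powi (- (int (p * q) - 1))
             + of_bool (\<xi> ^ p = 1) * \<xi> powi (- (int p - 1))
             + of_bool (\<xi> ^ q = 1) * \<xi> powi (- (int q - 1))
             - of_bool (\<xi> = 1))"
    by blast
  moreover have "\<forall>z. norm z < 1 \<longrightarrow> summable (\<lambda>m. moment p q m * z ^ m) \<and> moment_gf p q z = ?G z"
    using sums gf by (auto simp: sums_iff)
  ultimately show ?thesis
    unfolding torus_gf_def by blast
qed

end
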